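(* Let $\{a_\nu(x)\}_{\nu\ge 0}$ be a sequence of polynomials in $\mathbb{C}[x]$ with $\deg a_\nu\le \nu$ for all $\nu\ge 0$, let $J:\mathcal P\to\mathcal P$ be the linear operator $$J=\sum_{\nu\ge 0}\frac{a_\nu(x)}{\nu!}D^\nu ,$$ and for each integer $m\ge 0$ let $J^{(m)}:\mathcal P\to\mathcal P$ be the linear operator $$J^{(m)}=\sum_{n\ge 0}\frac{a_{n+m}(x)}{n!}D^n .$$ Then for every integer $i\ge 0$ and every polynomial $p\in\mathcal P$, $$J^{(i)}\big(x\,p(x)\big)=J^{(i+1)}\big(p(x)\big)+x\,J^{(i)}\big(p(x)\big).$$
   Context: $\mathcal P$ denotes the vector space of polynomials in one variable $x$ with coefficients in $\mathbb C$, and $D$ is the usual derivative $d/dx$ on $\mathcal P$. The sums defining the operators are finite when applied to any given polynomial. Note $J^{(0)}=J$; here $J^{(m)}$ is not a power or a derivative of $J$, just the operator defined by the displayed formula. *)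

theory Defs
  imports Complex_Main "HOL-Computational_Algebra.Polynomial" "HOL-Library.Groups_Big_Fun"
begin

(* Sum_any sums over all natural numbers n with a nonzero summand. It would silently be 0 for
   infinite support, but this never happens here: see finite_support_J_shift below.
   J_shift a m is the operator written J^(m); it is neither a power nor a derivative of J. *)

definition J_op :: "(nat \<Rightarrow> complex poly) \<Rightarrow> complex poly \<Rightarrow> complex poly" where
  "J_op a p = Sum_any (\<lambda>\<nu>. smult (1 / fact \<nu>) (a \<nu> * (pderiv ^^ \<nu>) p))"

definition J_shift :: "(nat \<Rightarrow> complex poly) \<Rightarrow> nat \<Rightarrow> complex poly \<Rightarrow> complex poly" where
  "J_shift a m p = Sum_any (\<lambda>n. smult (1 / fact n) (a (n + m) * (pderiv ^^ n) p))"

lemma J_shift_0: "J_shift a 0 = J_op a"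
  by (simp add: fun_eq_iff J_shift_def J_op_def)

lemma higher_pderiv_eq_0:
  fixes p :: "complex poly"
  assumes "degree p < n"
  shows "(pderiv ^^ n) p = 0"
  using assms by (intro poly_eqI) (simp add: coeff_higher_pderiv coeff_eq_0)

lemma support_J_shift:
  "{n. smult (1 / fact n) (a (n + m) * (pderiv ^^ n) (p :: complex poly)) \<noteq> 0} \<subseteq> {..degree p}"
proof
  fix n
  assume "n \<in> {n. smult (1 / fact n) (a (n + m) * (pderiv ^^ n) p) \<noteq> 0}"
  then have "(pderiv ^^ n) p \<noteq> 0" by auto
  then show "n \<in> {..degree p}" using higher_pderiv_eq_0[of p n] by (metis atMost_iff not_le)
qed

lemma finite_support_J_shift:
  "finite {n. smult (1 / fact n) (a (n + m) * (pderiv ^^ n) (p :: complex poly)) \<noteq> 0}"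
  by (rule finite_subset[OF support_J_shift]) simp

lemma J_shift_eq_sum:
  assumes "degree p \<le> N"
  shows "J_shift a m p = (\<Sum>n\<le>N. smult (1 / fact n) (a (n + m) * (pderiv ^^ n) p))"
  unfolding J_shift_def
proof (rule Sum_any.expand_superset)
  have "{..degree p} \<subseteq> {..N}" using assms by simp
  then show "{n. smult (1 / fact n) (a (n + m) * (pderiv ^^ n) p) \<noteq> 0} \<subseteq> {..N}"
    by (rule subset_trans[OF support_J_shift])
qed simp

lemma J_shift_add: "J_shift a m (p + q) = J_shift a m p + J_shift a m q"
proof -
  define N where "N = max (degree p) (degree q)"
  have "degree p \<le> N" "degree q \<le> N" "degree (p + q) \<le> N"
    by (simp_all add: N_def degree_add_le)
  note this[THEN J_shift_eq_sum]
  then show ?thesis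
    by (simp only: higher_pderiv_add distrib_left smult_add_right sum.distrib)
qed

lemma J_shift_smult: "J_shift a m (smult c p) = smult c (J_shift a m p)"
proof -
  interpret additive "smult c :: complex poly \<Rightarrow> _"
    by unfold_locales (rule smult_add_right)
  show ?thesis
    unfolding J_shift_eq_sum[OF degree_smult_le, of a m c p] J_shift_eq_sum[OF order_refl, of a m p] sum
    by (rule sum.cong[OF refl]) (simp add: higher_pderiv_smult mult.commute)
qed

lemma linear_J_shift: "Vector_Spaces.linear smult smult (J_shift a m)"
  by unfold_locales (simp_all add: smult_add_right smult_add_left J_shift_add J_shift_smult)

end

theory Submission
  imports Defs
begin

text \<open>The identity says that the commutator of J^(i) with multiplication by x is J^(i+1). It
  holds termwise: by Leibniz the commutator of D^n with x is n D^(n-1)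
  (\<open>higher_pderiv_X_mult\<close>), and n/n! = 1/(n-1)!, so replacing n by n+1 turns the
  coefficient a_(n+i) into a_(n+i+1). \<open>J_shift_eq_sum\<close> makes all sums finite with
  bounds of choice.\<close>

text \<open>Only two Leibniz terms survive because x has second derivative 0. The order
  \<open>Suc n\<close> avoids truncated subtraction in n - 1.\<close>

lemma higher_pderiv_X_mult:
  fixes p :: "complex poly"
  shows "(pderiv ^^ Suc n) ([:0, 1:] * p) =
    [:0, 1:] * (pderiv ^^ Suc n) p + smult (of_nat (Suc n)) ((pderiv ^^ n) p)"
proof (induction n)
  case 0
  show ?case by (simp add: pderiv_mult pderiv_pCons)
next
  case (Suc n)
  have "(pderiv ^^ Suc (Suc n)) ([:0, 1:] * p) = pderiv ((pderiv ^^ Suc n) ([:0, 1:] * p))"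
    by simp
  also have "\<dots> = [:0, 1:] * (pderiv ^^ Suc (Suc n)) p + (pderiv ^^ Suc n) p
      + smult (of_nat (Suc n)) ((pderiv ^^ Suc n) p)"
    unfolding Suc.IH by (simp add: pderiv_add pderiv_mult pderiv_smult pderiv_pCons)
  also have "\<dots> = [:0, 1:] * (pderiv ^^ Suc (Suc n)) p
      + smult (of_nat (Suc (Suc n))) ((pderiv ^^ Suc n) p)"
    by (simp only: of_nat_Suc[of "Suc n"] smult_add_left smult_1_left add.assoc)
  finally show ?case .
qed

theorem proposition2p5:
  fixes a :: "nat \<Rightarrow> complex poly"
    and i :: nat
    and p :: "complex poly"
  assumes "\<And>\<nu>. degree (a \<nu>) \<le> \<nu>"
  shows "J_shift a i ([:0, 1:] * p) = J_shift a (i + 1) p + [:0, 1:] * J_shift a i p"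
proof -
  define N where "N = degree p"
  \<comment> \<open>Both J^(i) sums run to \<open>Suc N\<close>, so that without index 0 they match
    the J^(i+1) sum up to \<open>N\<close>; for \<open>p\<close> the extra top term is 0.\<close>
  have deg: "degree ([:0, 1:] * p) \<le> Suc N" "degree p \<le> Suc N" "degree p \<le> N"
    using degree_mult_le[of "[:0, 1:]" p] by (simp_all add: N_def)
  have step: "smult (1 / fact (Suc n)) (a (Suc n + i) * (pderiv ^^ Suc n) ([:0, 1:] * p)) =
      smult (1 / fact n) (a (n + (i + 1)) * (pderiv ^^ n) p)
      + [:0, 1:] * smult (1 / fact (Suc n)) (a (Suc n + i) * (pderiv ^^ Suc n) p)" for n
  proof -
    have "1 / fact (Suc n) * of_nat (Suc n) = (1 / fact n :: complex)"
      by (simp add: divide_simps del: of_nat_Suc)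
    then have "smult (1 / fact (Suc n)) (smult (of_nat (Suc n)) q) = smult (1 / fact n) q"
      for q :: "complex poly"
      by (simp only: smult_smult)
    then show ?thesis
      by (simp only: higher_pderiv_X_mult distrib_left smult_add_right mult_smult_right
          mult.left_commute add.commute add_Suc_right add_0_left add_0_right One_nat_def)
  qed
  \<comment> \<open>The term of index 0 is split off: it involves no derivative, so it contributes
    only to x J^(i) p, and \<open>step\<close> covers the rest.\<close>
  have "J_shift a i ([:0, 1:] * p) =
      a i * ([:0, 1:] * p)
      + (\<Sum>n\<le>N. smult (1 / fact (Suc n)) (a (Suc n + i) * (pderiv ^^ Suc n) ([:0, 1:] * p)))"
    unfolding J_shift_eq_sum[OF deg(1)] sum.atMost_Suc_shift by simp
  also have "\<dots> = J_shift a (i + 1) p + [:0, 1:] * (a i * p +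
      (\<Sum>n\<le>N. smult (1 / fact (Suc n)) (a (Suc n + i) * (pderiv ^^ Suc n) p)))"
    unfolding step sum.distrib J_shift_eq_sum[OF deg(3)] distrib_left sum_distrib_left
    by (simp only: mult.left_commute add.left_commute)
  also have "a i * p + (\<Sum>n\<le>N. smult (1 / fact (Suc n)) (a (Suc n + i) * (pderiv ^^ Suc n) p)) =
      J_shift a i p"
    unfolding J_shift_eq_sum[OF deg(2)] sum.atMost_Suc_shift by simp
  finally show ?thesis .
qed

end
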